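(* For every $k \in \mathbb{Z}_{>0}$, there is a lattice $\Lambda_k \subseteq \mathbb{R}^3$ with at least $k$ Voronoi-relevant vectors with respect to the (smooth and strictly convex) $\ell_3$-norm $\Vert \cdot \Vert_3$.
   Context: A lattice $\Lambda \subseteq \mathbb{R}^n$ is a discrete additive subgroup of $\mathbb{R}^n$; all lattices are assumed to have full rank $n$, i.e. $\Lambda$ spans $\mathbb{R}^n$ over $\mathbb{R}$. A vector $v \in \Lambda \setminus \{0\}$ is Voronoi-relevant with respect to a norm $\Vert\cdot\Vert$ if there is some $x \in \mathbb{R}^n$ such that $\Vert x \Vert = \Vert x-v \Vert < \Vert x-w \Vert$ for all $w \in \Lambda \setminus \{0,v\}$. $\Vert x \Vert_3 = (|x_1|^3+|x_2|^3+|x_3|^3)^{1/3}$ for $x\in\mathbb{R}^3$. A norm is strictly convex if for all distinct $x,y$ with $\Vert x \Vert = \Vert y \Vert$ and all $\tau \in (0,1)$ we have $\Vert \tau x + (1-\tau) y \Vert < \Vert x \Vert$; it is smooth if each boundary point of its closed unit ball has a unique supporting hyperplane. *)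

theory Defs
  imports "HOL-Analysis.Analysis"
begin

definition full_rank_lattice :: "'a::euclidean_space set \<Rightarrow> bool" where
  "full_rank_lattice L \<longleftrightarrow>
     0 \<in> L \<and> (\<forall>x\<in>L. \<forall>y\<in>L. x + y \<in> L) \<and> (\<forall>x\<in>L. - x \<in> L) \<and>
     discrete L \<and> span L = UNIV"

text \<open>
  Norms are real-valued functions satisfying \<open>is_norm\<close>. The norm carried by the type,
  which is Euclidean on \<^typ>\<open>real ^ 3\<close>, enters only through the topology
  (in \<^const>\<open>discrete\<close> and \<^const>\<open>frontier\<close>).
\<close>

definition is_norm :: "('a::euclidean_space \<Rightarrow> real) \<Rightarrow> bool" where
  "is_norm N \<longleftrightarrow>
     (\<forall>x. 0 \<le> N x) \<and> (\<forall>x. N x = 0 \<longleftrightarrow> x = 0) \<and>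
     (\<forall>c x. N (c *\<^sub>R x) = \<bar>c\<bar> * N x) \<and> (\<forall>x y. N (x + y) \<le> N x + N y)"

definition strictly_convex :: "('a::euclidean_space \<Rightarrow> real) \<Rightarrow> bool" where
  "strictly_convex N \<longleftrightarrow>
     (\<forall>x y. x \<noteq> y \<and> N x = N y \<longrightarrow>
        (\<forall>\<tau>. 0 < \<tau> \<and> \<tau> < 1 \<longrightarrow> N (\<tau> *\<^sub>R x + (1 - \<tau>) *\<^sub>R y) < N x))"

text \<open>A hyperplane is taken as a set, so that uniqueness below is not affected by
  rescaling the normal vector.\<close>

definition supporting_hyperplane_at :: "'a::euclidean_space set \<Rightarrow> 'a \<Rightarrow> 'a set \<Rightarrow> bool" where
  "supporting_hyperplane_at S x H \<longleftrightarrow>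
     (\<exists>a b. a \<noteq> 0 \<and> H = {y. a \<bullet> y = b} \<and> x \<in> H \<and> S \<subseteq> {y. a \<bullet> y \<le> b})"

definition smooth :: "('a::euclidean_space \<Rightarrow> real) \<Rightarrow> bool" where
  "smooth N \<longleftrightarrow>
     (\<forall>x \<in> frontier {y. N y \<le> 1}. \<exists>!H. supporting_hyperplane_at {y. N y \<le> 1} x H)"

definition voronoi_relevant :: "('a::euclidean_space \<Rightarrow> real) \<Rightarrow> 'a set \<Rightarrow> 'a \<Rightarrow> bool" where
  "voronoi_relevant N L v \<longleftrightarrow>
     v \<in> L - {0} \<and>
     (\<exists>x. N x = N (x - v) \<and> (\<forall>w \<in> L - {0, v}. N (x - v) < N (x - w)))"

definition l3_norm :: "real ^ 3 \<Rightarrow> real" where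
  "l3_norm x = root 3 (\<bar>x $ 1\<bar> ^ 3 + \<bar>x $ 2\<bar> ^ 3 + \<bar>x $ 3\<bar> ^ 3)"

end

theory Submission
  imports Defs
begin

text \<open>
  Let \<open>b1 = (2C, 2C, \<tau>)\<close>, \<open>b2 = (\<alpha>, -\<alpha>, -1)\<close>, \<open>b3 = (0, 0, D)\<close> with \<open>A = 6 C \<alpha>\<^sup>2\<close> fixed,
  \<open>C\<close> large and \<open>D\<close> even larger. Since \<open>(T + y)\<^sup>3 + (T - y)\<^sup>3 = 2 T\<^sup>3 + 6 T y\<^sup>2\<close>, the cubed distance from
  \<open>x = (C (1 + r) + \<alpha> \<eta>, C (1 + r) - \<alpha> \<eta>, p)\<close> to \<open>n b2\<close> is
  \<open>2 C\<^sup>3 (1 + r)\<^sup>3 + A (1 + r) (\<eta> - n)\<^sup>2 + |p + n|\<^sup>3\<close>, and to \<open>b1 + n b2\<close> it is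
  \<open>2 C\<^sup>3 (1 - r)\<^sup>3 + A (1 - r) (\<eta> - n)\<^sup>2 + |p - \<tau> + n|\<^sup>3\<close>.
  Because a square competes with a cube here, the minimisers of these two convex functions
  of \<open>n\<close> drift apart as \<open>p\<close> varies: with \<open>\<tau> = 2k\<close> and \<open>A = 6 \<tau>\<^sup>2\<close>, for each \<open>l = 1, ..., k\<close>
  suitable \<open>p\<close> and \<open>\<eta>\<close> put them at \<open>0\<close> and \<open>l\<close> when \<open>r = 0\<close>. A tiny \<open>r\<close>, found by the
  intermediate value theorem, makes the two minima equal. Then \<open>x\<close> is equidistant from \<open>0\<close> and
  \<open>b1 + l b2\<close>, and all other lattice points are farther away.
\<close>

section \<open>Smoothness and strict convexity of the norm\<close>

text \<open>For \<open>s, t \<ge> 0\<close> the gap factors as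
  \<open>(t - s)^2 * (t + 2 * s)\<close>. For \<open>t < 0 \<le> s\<close> the tangent value is
  already nonpositive, and negative \<open>s\<close> follows by reflection.\<close>

lemma abs_cube_tangent_less:
  fixes s t :: real
  assumes "s \<noteq> t"
  shows "\<bar>s\<bar> ^ 3 + 3 * (s * \<bar>s\<bar>) * (t - s) < \<bar>t\<bar> ^ 3"
proof -
  have main: "a ^ 3 + 3 * (a * a) * (b - a) < \<bar>b\<bar> ^ 3" if "a \<ge> 0" "a \<noteq> b" for a b :: real
  proof (cases "b \<ge> 0")
    case True
    then have "0 < (b - a)\<^sup>2 * (b + 2 * a)"
      using that by (intro mult_pos_pos) auto
    also have "\<dots> = b ^ 3 - (a ^ 3 + 3 * (a * a) * (b - a))"
      by (simp add: power2_eq_square power3_eq_cube algebra_simps)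
    finally show ?thesis using True by simp
  next
    case False
    have "a ^ 3 + 3 * (a * a) * (b - a) = 3 * (a * a) * b - 2 * a ^ 3"
      by (simp add: power3_eq_cube algebra_simps)
    also have "\<dots> \<le> 0"
    proof -
      have "3 * (a * a) * b \<le> 0" using False by (intro mult_nonneg_nonpos) auto
      moreover have "0 \<le> a ^ 3" using that by simp
      ultimately show ?thesis by linarith
    qed
    also have "\<dots> < \<bar>b\<bar> ^ 3" using False by simp
    finally show ?thesis .
  qed
  show ?thesis
  proof (cases "s \<ge> 0")
    case True
    then show ?thesis using main[of s t] assms by simp
  next
    case False
    then show ?thesis using main[of "-s" "-t"] assms by (simp add: algebra_simps)
  qed
qed

lemma abs_cube_tangent_le:
  fixes s t :: real
  shows "\<bar>s\<bar> ^ 3 + 3 * (s * \<bar>s\<bar>) * (t - s) \<le> \<bar>t\<bar> ^ 3"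
  using abs_cube_tangent_less[of s t] by (cases "s = t") auto

text \<open>Without a sign change this is the binomial expansion. With one, substituting
  \<open>b = - (a + u)\<close> turns the gap into a polynomial in \<open>a\<close> and
  \<open>u\<close> with nonnegative coefficients.\<close>

lemma abs_cube_Taylor_upper:
  fixes s h :: real
  shows "\<bar>s + h\<bar> ^ 3 \<le> \<bar>s\<bar> ^ 3 + 3 * (s * \<bar>s\<bar>) * h + (3 * \<bar>s\<bar> * h\<^sup>2 + \<bar>h\<bar> ^ 3)"
proof -
  have main: "\<bar>a + b\<bar> ^ 3 \<le> a ^ 3 + 3 * (a * a) * b + (3 * a * b\<^sup>2 + \<bar>b\<bar> ^ 3)" if "a \<ge> 0" for a b :: real
  proof (cases "a + b \<ge> 0")
    case True
    have "b ^ 3 \<le> \<bar>b\<bar> ^ 3" by (metis abs_ge_self power_abs)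
    then show ?thesis using True by (simp add: power2_eq_square power3_eq_cube algebra_simps)
  next
    case False
    define u where "u = - (a + b)"
    have u: "u > 0" "b = - (a + u)" using False by (auto simp: u_def)
    have "0 \<le> 2 * a ^ 3 + 6 * (a * a * u) + 6 * (a * u * u)"
      using u that by simp
    then show ?thesis
      unfolding u(2) using u(1) that by (simp add: power2_eq_square power3_eq_cube algebra_simps)
  qed
  show ?thesis
  proof (cases "s \<ge> 0")
    case True
    then show ?thesis using main[of s h] by simp
  next
    case False
    have "\<bar>- s - h\<bar> = \<bar>s + h\<bar>" by linarith
    then show ?thesis using main[of "-s" "-h"] False by simp
  qed
qed

lemma abs_cube_add_diff_eq:
  fixes u v :: real
  assumes "\<bar>v\<bar> \<le> \<bar>u\<bar>"
  shows "\<bar>u + v\<bar> ^ 3 + \<bar>u - v\<bar> ^ 3 = 2 * \<bar>u\<bar> ^ 3 + 6 * \<bar>u\<bar> * v\<^sup>2"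
proof (cases "u \<ge> 0")
  case True
  then have "\<bar>u + v\<bar> = u + v" "\<bar>u - v\<bar> = u - v" using assms by auto
  then show ?thesis using True by (simp add: power2_eq_square power3_eq_cube algebra_simps)
next
  case False
  then have "\<bar>u + v\<bar> = - u - v" "\<bar>u - v\<bar> = v - u" "\<bar>u\<bar> = - u" using assms by auto
  then show ?thesis by (simp add: power2_eq_square power3_eq_cube algebra_simps)
qed

text \<open>If \<open>|v| > |u|\<close>, the exact formula holds with \<open>u\<close> and
  \<open>v\<close> exchanged, and it exceeds the left side by \<open>2 * (|v| - |u|)^3\<close>. This
  bounds distances to lattice points for which the exact formula may fail.\<close>

lemma abs_cube_add_diff_ge:
  fixes u v :: real
  shows "2 * \<bar>u\<bar> ^ 3 + 6 * \<bar>u\<bar> * v\<^sup>2 \<le> \<bar>u + v\<bar> ^ 3 + \<bar>u - v\<bar> ^ 3"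
proof (cases "\<bar>v\<bar> \<le> \<bar>u\<bar>")
  case True
  then show ?thesis using abs_cube_add_diff_eq by simp
next
  case False
  have "0 \<le> 2 * (\<bar>v\<bar> - \<bar>u\<bar>) ^ 3" using False by simp
  also have "\<dots> = (2 * \<bar>v\<bar> ^ 3 + 6 * \<bar>v\<bar> * u\<^sup>2) - (2 * \<bar>u\<bar> ^ 3 + 6 * \<bar>u\<bar> * v\<^sup>2)"
  proof -
    have "2 * (b - a) ^ 3 = (2 * b ^ 3 + 6 * b * a\<^sup>2) - (2 * a ^ 3 + 6 * a * b\<^sup>2)" for a b :: real
      by (simp add: power2_eq_square power3_eq_cube algebra_simps)
    from this[of "\<bar>v\<bar>" "\<bar>u\<bar>"] show ?thesis by simp
  qed
  also have "2 * \<bar>v\<bar> ^ 3 + 6 * \<bar>v\<bar> * u\<^sup>2 = \<bar>u + v\<bar> ^ 3 + \<bar>u - v\<bar> ^ 3"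
    using abs_cube_add_diff_eq[of u v] abs_cube_add_diff_eq[of v u] False
    by (simp add: add.commute abs_minus_commute)
  finally show ?thesis by simp
qed

section \<open>The cubed norm and its gradient\<close>

text \<open>The cube of \<open>l3_norm\<close>. Norm comparisons reduce to it because
  \<open>root 3\<close> is strictly increasing, and it splits into functions of one
  coordinate.\<close>

definition cube_sum :: "real ^ 3 \<Rightarrow> real" where
  "cube_sum x = \<bar>x $ 1\<bar> ^ 3 + \<bar>x $ 2\<bar> ^ 3 + \<bar>x $ 3\<bar> ^ 3"

text \<open>One third of the gradient of \<open>cube_sum\<close>.\<close>

definition cube_grad :: "real ^ 3 \<Rightarrow> real ^ 3" where
  "cube_grad x = vector [x $ 1 * \<bar>x $ 1\<bar>, x $ 2 * \<bar>x $ 2\<bar>, x $ 3 * \<bar>x $ 3\<bar>]"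

lemma inner_real3: "(x :: real ^ 3) \<bullet> y = x $ 1 * y $ 1 + x $ 2 * y $ 2 + x $ 3 * y $ 3"
  by (simp add: inner_vec_def sum_3)

lemma cube_sum_nonneg: "0 \<le> cube_sum x"
  by (simp add: cube_sum_def)

lemma cube_sum_eq_0_iff: "cube_sum x = 0 \<longleftrightarrow> x = 0"
proof -
  have "cube_sum x = 0 \<longleftrightarrow> \<bar>x $ 1\<bar> ^ 3 = 0 \<and> \<bar>x $ 2\<bar> ^ 3 = 0 \<and> \<bar>x $ 3\<bar> ^ 3 = 0"
    unfolding cube_sum_def
    using zero_le_power[OF abs_ge_zero, of "x $ 1" 3] zero_le_power[OF abs_ge_zero, of "x $ 2" 3]
      zero_le_power[OF abs_ge_zero, of "x $ 3" 3]
    by linarith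
  then show ?thesis by (simp add: vec_eq_iff forall_3)
qed

lemma cube_sum_scaleR: "cube_sum (c *\<^sub>R x) = \<bar>c\<bar> ^ 3 * cube_sum x"
  by (simp add: cube_sum_def abs_mult power_mult_distrib algebra_simps)

lemma cube_sum_tangent_less:
  assumes "x \<noteq> y"
  shows "cube_sum x + 3 * (cube_grad x \<bullet> (y - x)) < cube_sum y"
proof -
  define F where "F i = \<bar>x $ i\<bar> ^ 3 + 3 * (x $ i * \<bar>x $ i\<bar>) * (y $ i - x $ i)" for i
  have le: "F i \<le> \<bar>y $ i\<bar> ^ 3" for i
    unfolding F_def by (rule abs_cube_tangent_le)
  obtain i where "x $ i \<noteq> y $ i"
    using assms by (auto simp: vec_eq_iff)
  then have "F i < \<bar>y $ i\<bar> ^ 3"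
    unfolding F_def by (rule abs_cube_tangent_less)
  then have "sum F UNIV < (\<Sum>i\<in>UNIV. \<bar>y $ i\<bar> ^ 3)"
    by (intro sum_strict_mono_ex1) (use le in auto)
  then show ?thesis
    by (simp add: F_def sum_3 cube_sum_def cube_grad_def inner_real3 algebra_simps)
qed

lemma cube_sum_tangent_le: "cube_sum x + 3 * (cube_grad x \<bullet> (y - x)) \<le> cube_sum y"
  using cube_sum_tangent_less[of x y] by (cases "x = y") auto

lemma cube_grad_inner_self: "cube_grad x \<bullet> x = cube_sum x"
proof -
  have "\<bar>t\<bar> ^ 3 = t * \<bar>t\<bar> * t" for t :: real
    by (cases "t \<ge> 0") (auto simp: power3_eq_cube)
  then show ?thesis by (simp add: cube_grad_def inner_real3 cube_sum_def)
qed

text \<open>The tangent inequality at the convex combination \<open>z\<close> is applied towards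
  \<open>x\<close> and towards \<open>y\<close>. In the weighted sum the linear terms
  cancel.\<close>

lemma cube_sum_strictly_convex:
  assumes "x \<noteq> y" "0 < t" "t < 1"
  shows "cube_sum (t *\<^sub>R x + (1 - t) *\<^sub>R y) < t * cube_sum x + (1 - t) * cube_sum y"
proof -
  define z where "z = t *\<^sub>R x + (1 - t) *\<^sub>R y"
  have zx: "x - z = (1 - t) *\<^sub>R (x - y)" and zy: "y - z = (- t) *\<^sub>R (x - y)"
    by (simp_all add: z_def algebra_simps)
  then have "z \<noteq> x" "z \<noteq> y" using assms by auto
  then have "t * (cube_sum z + 3 * (cube_grad z \<bullet> (x - z))) < t * cube_sum x"
    and "(1 - t) * (cube_sum z + 3 * (cube_grad z \<bullet> (y - z))) < (1 - t) * cube_sum y"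
    using assms by (auto intro: mult_strict_left_mono cube_sum_tangent_less)
  then show ?thesis
    unfolding zx zy z_def[symmetric] by (simp add: algebra_simps)
qed

text \<open>Along \<open>w\<close> the first-order decrease is \<open>3 * t * d\<close>, while the
  Taylor remainder is at most \<open>t^2 * R\<close> for \<open>t \<le> 1\<close>, so a small step
  wins.\<close>

lemma cube_sum_descent:
  assumes "cube_grad x \<bullet> w < 0"
  shows "\<exists>t>0. cube_sum (x + t *\<^sub>R w) < cube_sum x"
proof -
  define R where "R = (\<Sum>i\<in>UNIV. 3 * \<bar>x $ i\<bar> * (w $ i)\<^sup>2 + \<bar>w $ i\<bar> ^ 3)"
  define d where "d = - (cube_grad x \<bullet> w)"
  have "R \<ge> 0" unfolding R_def by (intro sum_nonneg) auto
  have "d > 0" using assms by (simp add: d_def)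
  \<comment> \<open>The bound 1 lets \<open>t^3\<close> be absorbed into \<open>t^2\<close>. The
    \<open>+ 1\<close> makes the denominator positive without a proof of
    \<open>R > 0\<close>.\<close>
  define t where "t = min 1 (d / (R + 1))"
  have t: "0 < t" "t \<le> 1" "t * R < 3 * d"
  proof -
    show "0 < t" "t \<le> 1" using \<open>d > 0\<close> \<open>R \<ge> 0\<close> by (auto simp: t_def)
    have "t * R \<le> d / (R + 1) * R" using \<open>R \<ge> 0\<close> by (intro mult_right_mono) (auto simp: t_def)
    also have "\<dots> \<le> d" using \<open>R \<ge> 0\<close> \<open>d > 0\<close> by (simp add: field_simps)
    finally show "t * R < 3 * d" using \<open>d > 0\<close> by linarith
  qed
  have *: "\<bar>s + t * h\<bar> ^ 3 \<le> \<bar>s\<bar> ^ 3 + 3 * (s * \<bar>s\<bar>) * (t * h) + t\<^sup>2 * (3 * \<bar>s\<bar> * h\<^sup>2 + \<bar>h\<bar> ^ 3)" for s h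
  proof -
    have "t ^ 3 * \<bar>h\<bar> ^ 3 \<le> t\<^sup>2 * \<bar>h\<bar> ^ 3"
      using t by (intro mult_right_mono power_decreasing) auto
    then show ?thesis
      using abs_cube_Taylor_upper[of s "t * h"] t
      by (simp add: abs_mult power_mult_distrib algebra_simps)
  qed
  have "cube_sum (x + t *\<^sub>R w) \<le> cube_sum x + t * (3 * (cube_grad x \<bullet> w)) + t\<^sup>2 * R"
    using *[of "x $ 1" "w $ 1"] *[of "x $ 2" "w $ 2"] *[of "x $ 3" "w $ 3"]
    by (simp add: cube_sum_def R_def sum_3 cube_grad_def inner_real3 algebra_simps)
  also have "\<dots> = cube_sum x + t * (t * R - 3 * d)"
    by (simp add: d_def power2_eq_square algebra_simps)
  also have "\<dots> < cube_sum x" using t by (simp add: mult_pos_neg)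
  finally show ?thesis using t by blast
qed

section \<open>Norm axioms and strict convexity\<close>

lemma l3_norm_cube_sum: "l3_norm x = root 3 (cube_sum x)"
  by (simp add: l3_norm_def cube_sum_def)

lemma l3_norm_less_iff: "l3_norm x < l3_norm y \<longleftrightarrow> cube_sum x < cube_sum y"
  by (simp add: l3_norm_cube_sum)

lemma l3_norm_eq_iff: "l3_norm x = l3_norm y \<longleftrightarrow> cube_sum x = cube_sum y"
  by (simp add: l3_norm_cube_sum)

lemma l3_norm_le_1_iff: "l3_norm x \<le> 1 \<longleftrightarrow> cube_sum x \<le> 1"
  by (simp add: l3_norm_cube_sum)

lemma l3_norm_strictly_convex: "strictly_convex l3_norm"
  unfolding strictly_convex_def
proof (intro allI impI)
  fix x y :: "real ^ 3" and t :: real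
  assume xy: "x \<noteq> y \<and> l3_norm x = l3_norm y" and t: "0 < t \<and> t < 1"
  then have "cube_sum (t *\<^sub>R x + (1 - t) *\<^sub>R y) < t * cube_sum x + (1 - t) * cube_sum x"
    using cube_sum_strictly_convex[of x y t] by (simp add: l3_norm_eq_iff)
  then show "l3_norm (t *\<^sub>R x + (1 - t) *\<^sub>R y) < l3_norm x"
    by (simp add: l3_norm_less_iff algebra_simps)
qed

lemma l3_norm_scaleR: "l3_norm (c *\<^sub>R x) = \<bar>c\<bar> * l3_norm x"
  by (simp add: l3_norm_cube_sum cube_sum_scaleR real_root_mult real_root_power_cancel)

lemma l3_norm_pos: "x \<noteq> 0 \<Longrightarrow> 0 < l3_norm x"
  using cube_sum_nonneg[of x] cube_sum_eq_0_iff[of x] by (simp add: l3_norm_cube_sum)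

text \<open>The triangle inequality is convexity of the unit ball, applied to the normalised vectors
  with weights proportional to their norms.\<close>

lemma l3_norm_triangle: "l3_norm (x + y) \<le> l3_norm x + l3_norm y"
proof (cases "x = 0 \<or> y = 0")
  case True
  then show ?thesis by (auto simp: l3_norm_cube_sum cube_sum_nonneg)
next
  case False
  define a where "a = l3_norm x"
  define b where "b = l3_norm y"
  define t where "t = a / (a + b)"
  define x' where "x' = (1 / a) *\<^sub>R x"
  define y' where "y' = (1 / b) *\<^sub>R y"
  have ab: "a > 0" "b > 0" using False l3_norm_pos by (auto simp: a_def b_def)
  have t: "0 < t" "t < 1" using ab by (auto simp: t_def)
  have "l3_norm x' = 1" "l3_norm y' = 1"
    using ab by (auto simp: x'_def y'_def l3_norm_scaleR a_def b_def)
  then have unit: "cube_sum x' = 1" "cube_sum y' = 1" by (simp_all add: l3_norm_cube_sum)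
  have "cube_sum (t *\<^sub>R x' + (1 - t) *\<^sub>R y') \<le> 1"
  proof (cases "x' = y'")
    case True
    then show ?thesis using unit by (simp add: algebra_simps)
  next
    case False
    then show ?thesis using cube_sum_strictly_convex[OF False t] unit by simp
  qed
  moreover have "(a + b) *\<^sub>R (t *\<^sub>R x' + (1 - t) *\<^sub>R y') = x + y"
  proof -
    have "(a + b) * t = a" "(a + b) * (1 - t) = b" using ab by (auto simp: t_def field_simps)
    then show ?thesis using ab by (simp add: scaleR_add_right x'_def y'_def)
  qed
  ultimately have "l3_norm (x + y) \<le> (a + b) * 1"
    using ab by (metis abs_of_pos add_pos_pos l3_norm_scaleR l3_norm_le_1_iff
        mult_left_mono less_imp_le)
  then show ?thesis by (simp add: a_def b_def)
qed

lemma is_norm_l3_norm: "is_norm l3_norm"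
  unfolding is_norm_def
  using l3_norm_triangle l3_norm_scaleR
  by (auto simp: l3_norm_cube_sum cube_sum_nonneg cube_sum_eq_0_iff)

section \<open>Supporting hyperplanes of the unit ball\<close>

lemma continuous_on_cube_sum: "continuous_on S cube_sum"
  unfolding cube_sum_def by (intro continuous_intros)

lemma frontier_l3_ball: "x \<in> frontier {y. l3_norm y \<le> 1} \<Longrightarrow> cube_sum x = 1"
proof -
  assume x: "x \<in> frontier {y. l3_norm y \<le> 1}"
  have eq: "{y. l3_norm y \<le> 1} = {y. cube_sum y \<le> 1}" by (simp add: l3_norm_le_1_iff)
  have "closed {y. cube_sum y \<le> 1}"
    by (intro closed_Collect_le continuous_on_cube_sum continuous_intros)
  then have "cube_sum x \<le> 1"
    using x frontier_subset_closed unfolding eq by blast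
  moreover have "open {y. cube_sum y < 1}"
    by (intro open_Collect_less continuous_on_cube_sum continuous_intros)
  then have "{y. cube_sum y < 1} \<subseteq> interior {y. cube_sum y \<le> 1}"
    by (intro interior_maximal) auto
  then have "\<not> cube_sum x < 1"
    using x unfolding eq frontier_def by auto
  ultimately show ?thesis by simp
qed

text \<open>The part \<open>w\<close> of \<open>a\<close> orthogonal to \<open>g\<close> must
  vanish. This makes the normal of a supporting hyperplane unique up to scaling.\<close>

lemma linear_functional_multiple_of_inner:
  fixes g a :: "'a::real_inner"
  assumes "g \<noteq> 0" and neg: "\<And>w. g \<bullet> w < 0 \<Longrightarrow> a \<bullet> w \<le> 0"
  obtains c where "a = c *\<^sub>R g"
proof -
  define w where "w = a - ((a \<bullet> g) / (g \<bullet> g)) *\<^sub>R g"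
  have gg: "g \<bullet> g > 0" using assms by simp
  have gw: "g \<bullet> w = 0" using gg by (simp add: w_def inner_diff_right inner_commute)
  have aw: "a \<bullet> w = w \<bullet> w"
    using gw by (simp add: w_def inner_diff_left inner_diff_right inner_commute)
  \<comment> \<open>Since \<open>w\<close> lies only on the boundary of the half-space in
    \<open>neg\<close>, it is tilted to \<open>w - s *\<^sub>R g\<close>, with \<open>s\<close> so
    small that the error is at most \<open>e\<close>.\<close>
  have "w \<bullet> w \<le> e" if "e > 0" for e
  proof -
    define s where "s = e / (\<bar>a \<bullet> g\<bar> + 1)"
    have s: "s > 0" using that by (simp add: s_def add_nonneg_pos)
    have "a \<bullet> (w - s *\<^sub>R g) \<le> 0"
      by (rule neg) (use gw gg s in \<open>simp add: inner_diff_right\<close>)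
    then have "w \<bullet> w \<le> s * (a \<bullet> g)" by (simp add: aw inner_diff_right)
    also have "\<dots> \<le> s * (\<bar>a \<bullet> g\<bar> + 1)" using s by (intro mult_left_mono) auto
    also have "\<dots> = e" by (simp add: s_def add_nonneg_pos)
    finally show ?thesis .
  qed
  then have "w \<bullet> w \<le> 0" by (meson field_le_epsilon add_0 dense_ge)
  then have "w = 0" by (metis inner_gt_zero_iff not_less)
  then show ?thesis using that[of "(a \<bullet> g) / (g \<bullet> g)"] by (simp add: w_def)
qed

text \<open>The tangent inequality shows that the hyperplane with normal \<open>cube_grad x\<close>
  supports the ball. Any other supporting normal is nonpositive on all descent directions at
  \<open>x\<close>, hence a multiple of \<open>cube_grad x\<close>.\<close>

lemma l3_norm_smooth: "smooth l3_norm"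
  unfolding smooth_def
proof
  fix x :: "real ^ 3"
  assume "x \<in> frontier {y. l3_norm y \<le> 1}"
  then have x1: "cube_sum x = 1" by (rule frontier_l3_ball)
  define g where "g = cube_grad x"
  have gx: "g \<bullet> x = 1" by (simp add: g_def cube_grad_inner_self x1)
  then have g0: "g \<noteq> 0" by auto
  let ?B = "{y. l3_norm y \<le> 1}"
  have "supporting_hyperplane_at ?B x {y. g \<bullet> y = 1}"
  proof -
    have "g \<bullet> y \<le> 1" if "cube_sum y \<le> 1" for y
      using cube_sum_tangent_le[of x y] that x1 gx
      unfolding g_def by (simp add: inner_diff_right)
    then show ?thesis
      unfolding supporting_hyperplane_at_def using g0 gx
      by (intro exI[of _ g] exI[of _ 1]) (auto simp: l3_norm_le_1_iff)
  qed
  moreover have "H = {y. g \<bullet> y = 1}" if "supporting_hyperplane_at ?B x H" for H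
  proof -
    from that obtain a b where ab: "a \<noteq> 0" "H = {y. a \<bullet> y = b}" "a \<bullet> x = b"
      and supp: "\<And>y. cube_sum y \<le> 1 \<Longrightarrow> a \<bullet> y \<le> b"
      unfolding supporting_hyperplane_at_def by (auto simp: l3_norm_le_1_iff)
    have "a \<bullet> w \<le> 0" if w: "g \<bullet> w < 0" for w
    proof -
      obtain t where "t > 0" "cube_sum (x + t *\<^sub>R w) < 1"
        using cube_sum_descent[of x w] w x1 by (auto simp: g_def)
      then have "t * (a \<bullet> w) \<le> 0"
        using supp[of "x + t *\<^sub>R w"] ab by (simp add: inner_add_right)
      then show ?thesis using \<open>t > 0\<close> by (simp add: mult_le_0_iff)
    qed
    then obtain c where c: "a = c *\<^sub>R g"
      using linear_functional_multiple_of_inner[OF g0] by blast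
    then have "c \<noteq> 0" "b = c" using ab gx by auto
    then show ?thesis unfolding ab(2) c by auto
  qed
  ultimately show "\<exists>!H. supporting_hyperplane_at ?B x H" by blast
qed

section \<open>The lattice and its Voronoi-relevant vectors\<close>

text \<open>This is \<open>j b1 + n b2 + m b3\<close> for the basis of the overview.\<close>

definition latvec :: "real \<Rightarrow> real \<Rightarrow> real \<Rightarrow> real \<Rightarrow> int \<Rightarrow> int \<Rightarrow> int \<Rightarrow> real ^ 3" where
  "latvec C \<alpha> \<tau> D j n m = vector
     [2 * C * of_int j + \<alpha> * of_int n, 2 * C * of_int j - \<alpha> * of_int n,
      \<tau> * of_int j - of_int n + D * of_int m]"

definition lattice :: "real \<Rightarrow> real \<Rightarrow> real \<Rightarrow> real \<Rightarrow> (real ^ 3) set" where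
  "lattice C \<alpha> \<tau> D = {latvec C \<alpha> \<tau> D j n m | j n m. True}"

lemma latvec_eq_0_iff:
  assumes "C \<noteq> 0" "\<alpha> \<noteq> 0" "D \<noteq> 0"
  shows "latvec C \<alpha> \<tau> D j n m = 0 \<longleftrightarrow> j = 0 \<and> n = 0 \<and> m = 0"
proof
  assume 0: "latvec C \<alpha> \<tau> D j n m = 0"
  have 1: "2 * C * of_int j + \<alpha> * of_int n = 0" and 2: "2 * C * of_int j - \<alpha> * of_int n = 0"
    and 3: "\<tau> * of_int j - of_int n + D * of_int m = 0"
    using arg_cong[OF 0, of "\<lambda>x. x $ 1"] arg_cong[OF 0, of "\<lambda>x. x $ 2"]
      arg_cong[OF 0, of "\<lambda>x. x $ 3"] by (simp_all add: latvec_def)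
  from 1 2 have "C * of_int j = 0" "\<alpha> * of_int n = 0" by linarith+
  then have "j = 0" "n = 0" using assms by simp_all
  then show "j = 0 \<and> n = 0 \<and> m = 0" using 3 assms by simp
qed (simp add: latvec_def vec_eq_iff forall_3)

lemma latvec_add:
  "latvec C \<alpha> \<tau> D j n m + latvec C \<alpha> \<tau> D j' n' m' = latvec C \<alpha> \<tau> D (j + j') (n + n') (m + m')"
  by (simp add: latvec_def vec_eq_iff forall_3 algebra_simps)

lemma latvec_minus: "- latvec C \<alpha> \<tau> D j n m = latvec C \<alpha> \<tau> D (- j) (- n) (- m)"
  by (simp add: latvec_def vec_eq_iff forall_3 algebra_simps)

lemma latvec_diff:
  "latvec C \<alpha> \<tau> D j n m - latvec C \<alpha> \<tau> D j' n' m' = latvec C \<alpha> \<tau> D (j - j') (n - n') (m - m')"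
  by (simp add: latvec_def vec_eq_iff forall_3 algebra_simps)

lemma abs_mult_of_int_less_imp_eq_0:
  fixes c :: real
  assumes "\<bar>c * of_int i\<bar> < c"
  shows "i = 0"
proof (rule ccontr)
  assume "i \<noteq> 0"
  have "c > 0" using assms by linarith
  have "1 \<le> \<bar>real_of_int i\<bar>" using \<open>i \<noteq> 0\<close> by linarith
  then have "c * 1 \<le> c * \<bar>real_of_int i\<bar>" using \<open>c > 0\<close> by (intro mult_left_mono) auto
  then show False using assms \<open>c > 0\<close> by (simp add: abs_mult)
qed

text \<open>The sum and difference of the first two coordinates isolate \<open>j\<close> and
  \<open>n\<close>; the third then isolates \<open>m\<close>. Applied to differences of lattice
  vectors, this gives discreteness.\<close>

lemma latvec_small_imp_0:
  assumes small: "norm (latvec C \<alpha> \<tau> D j n m) < Min {C, \<alpha>, D}"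
  shows "j = 0 \<and> n = 0 \<and> m = 0"
proof -
  let ?v = "latvec C \<alpha> \<tau> D j n m"
  have comp: "\<bar>?v $ i\<bar> < C" "\<bar>?v $ i\<bar> < \<alpha>" "\<bar>?v $ i\<bar> < D" for i
    using component_le_norm_cart[of ?v i] small by auto
  have "2 * (2 * C * of_int j) = ?v $ 1 + ?v $ 2" "2 * (\<alpha> * of_int n) = ?v $ 1 - ?v $ 2"
    by (simp_all add: latvec_def)
  then have "\<bar>C * of_int j\<bar> < C" "\<bar>\<alpha> * of_int n\<bar> < \<alpha>"
    using comp[of 1] comp[of 2] by linarith+
  then have "j = 0" "n = 0" using abs_mult_of_int_less_imp_eq_0 by blast+
  moreover have "m = 0"
    using comp(3)[of 3] \<open>j = 0\<close> \<open>n = 0\<close>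
    by (intro abs_mult_of_int_less_imp_eq_0[of D]) (simp add: latvec_def)
  ultimately show ?thesis by simp
qed

lemma full_rank_lattice_lattice:
  assumes "C > 0" "\<alpha> > 0" "D > 0"
  shows "full_rank_lattice (lattice C \<alpha> \<tau> D)"
proof -
  let ?L = "lattice C \<alpha> \<tau> D" and ?v = "latvec C \<alpha> \<tau> D"
  have mem: "?v j n m \<in> ?L" for j n m by (auto simp: lattice_def)
  have zero: "0 \<in> ?L"
    using mem[of 0 0 0] latvec_eq_0_iff[of C \<alpha> D \<tau> 0 0 0] assms by simp
  have add: "x + y \<in> ?L" if "x \<in> ?L" "y \<in> ?L" for x y
    using that unfolding lattice_def mem_Collect_eq by (metis latvec_add)
  have minus: "- x \<in> ?L" if "x \<in> ?L" for x
    using that unfolding lattice_def mem_Collect_eq by (metis latvec_minus)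
  have "uniform_discrete ?L"
    unfolding uniform_discrete_def
  proof (intro exI[of _ "Min {C, \<alpha>, D}"] conjI ballI impI)
    show "0 < Min {C, \<alpha>, D}" using assms by simp
    fix x y assume "x \<in> ?L" "y \<in> ?L" and d: "dist x y < Min {C, \<alpha>, D}"
    then obtain j n m j' n' m' where xy: "x = ?v j n m" "y = ?v j' n' m'"
      unfolding lattice_def by auto
    then have "j - j' = 0 \<and> n - n' = 0 \<and> m - m' = 0"
      using d by (intro latvec_small_imp_0) (simp add: dist_norm latvec_diff)
    then show "x = y" by (simp add: xy)
  qed
  then have "discrete ?L" by (rule uniform_discrete_imp_discrete)
  moreover have "x \<in> span ?L" for x :: "real ^ 3"
  proof -
    define j where "j = (x $ 1 + x $ 2) / (4 * C)"
    define n where "n = (x $ 1 - x $ 2) / (2 * \<alpha>)"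
    define m where "m = (x $ 3 - \<tau> * j + n) / D"
    have "x = j *\<^sub>R ?v 1 0 0 + n *\<^sub>R ?v 0 1 0 + m *\<^sub>R ?v 0 0 1"
      using assms by (simp add: vec_eq_iff forall_3 latvec_def j_def n_def m_def field_simps)
    then show ?thesis
      by (metis mem span_base span_add span_scale)
  qed
  ultimately show ?thesis
    unfolding full_rank_lattice_def using zero add minus by blast
qed

section \<open>Distances from a probe point to the lattice\<close>

text \<open>The point \<open>x\<close> of the overview; \<open>r = 0\<close> places it midway
  between the layers \<open>j = 0\<close> and \<open>j = 1\<close>.\<close>

definition probe :: "real \<Rightarrow> real \<Rightarrow> real \<Rightarrow> real \<Rightarrow> real \<Rightarrow> real ^ 3" where
  "probe C \<alpha> r \<eta> p = vector [C * (1 + r) + \<alpha> * \<eta>, C * (1 + r) - \<alpha> * \<eta>, p]"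

text \<open>The first two coordinates of the difference are \<open>a + b\<close> and
  \<open>a - b\<close>, where \<open>a\<close> depends only on the layer \<open>j\<close> and
  \<open>b\<close> only on \<open>n\<close>. Equality is needed just for the two nearest points; the
  others need only the lower bound.\<close>

lemma cube_sum_probe_diff:
  fixes A C D \<alpha> r \<eta> p \<tau> :: real and j n m :: int
  assumes "C > 0" "A = 6 * C * \<alpha>\<^sup>2"
  defines "u \<equiv> \<lambda>j. \<bar>1 + r - 2 * real_of_int j\<bar>"
  defines "X \<equiv> cube_sum (probe C \<alpha> r \<eta> p - latvec C \<alpha> \<tau> D j n m)"
  defines "Y \<equiv> 2 * C ^ 3 * u j ^ 3 + A * u j * (\<eta> - of_int n)\<^sup>2
                 + \<bar>p - \<tau> * of_int j + of_int n - D * of_int m\<bar> ^ 3"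
  shows "Y \<le> X" and "\<bar>\<alpha> * (\<eta> - of_int n)\<bar> \<le> C * u j \<Longrightarrow> X = Y"
proof -
  define a where "a = C * (1 + r - 2 * real_of_int j)"
  define b where "b = \<alpha> * (\<eta> - of_int n)"
  have a: "\<bar>a\<bar> = C * u j" using assms(1) by (simp add: a_def u_def abs_mult)
  have X: "X = (\<bar>a + b\<bar> ^ 3 + \<bar>a - b\<bar> ^ 3) + \<bar>p - \<tau> * of_int j + of_int n - D * of_int m\<bar> ^ 3"
  proof -
    have "probe C \<alpha> r \<eta> p - latvec C \<alpha> \<tau> D j n m
        = vector [a + b, a - b, p - \<tau> * of_int j + of_int n - D * of_int m]"
      by (simp add: probe_def latvec_def vec_eq_iff forall_3 a_def b_def algebra_simps)
    then show ?thesis by (simp add: X_def cube_sum_def)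
  qed
  have Y: "Y = (2 * \<bar>a\<bar> ^ 3 + 6 * \<bar>a\<bar> * b\<^sup>2) + \<bar>p - \<tau> * of_int j + of_int n - D * of_int m\<bar> ^ 3"
    unfolding Y_def a by (simp add: b_def assms(2) power_mult_distrib)
  show "Y \<le> X" unfolding X Y using abs_cube_add_diff_ge[of a b] by simp
  show "X = Y" if "\<bar>\<alpha> * (\<eta> - of_int n)\<bar> \<le> C * u j"
    unfolding X Y using abs_cube_add_diff_eq[of b a] that a by (simp add: b_def)
qed

text \<open>The hypothesis \<open>2 * A * \<eta> = 3 * p\<^sup>2\<close> says that for \<open>r = 0\<close> and \<open>m = 0\<close> the convex
  function on the right is critical at \<open>n = 0\<close>.\<close>

lemma layer_minimum:
  fixes A p \<eta> :: real
  assumes A: "A > 0" and p: "p \<ge> 0" and crit: "2 * A * \<eta> = 3 * p\<^sup>2"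
  shows "\<exists>D0. \<forall>D\<ge>D0. \<forall>r. \<bar>r\<bar> \<le> 1/2 \<longrightarrow> \<bar>r\<bar> * (1 + 2 * \<bar>\<eta>\<bar>) < 1 \<longrightarrow>
    (\<forall>n m :: int. n \<noteq> 0 \<or> m \<noteq> 0 \<longrightarrow>
      A * (1 + r) * \<eta>\<^sup>2 + p ^ 3
        < A * (1 + r) * (\<eta> - of_int n)\<^sup>2 + \<bar>p + of_int n - D * of_int m\<bar> ^ 3)"
proof -
  \<comment> \<open>\<open>E\<close> bounds the left side for all \<open>|r| \<le> 1/2\<close>, and
    \<open>A / 2 * R\<close> exceeds \<open>E\<close>. \<open>D0\<close> pushes points with
    \<open>m \<noteq> 0\<close> and \<open>n\<close> within \<open>R\<close> of
    \<open>\<eta>\<close> beyond \<open>E\<close>.\<close>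
  define E where "E = A * (3/2) * \<eta>\<^sup>2 + p ^ 3"
  define R where "R = 1 + 2 * E / A"
  define D0 where "D0 = p + \<bar>\<eta>\<bar> + R + E + 1"
  have E: "E \<ge> 0" using A p by (simp add: E_def)
  have R: "R \<ge> 1" using A E by (simp add: R_def)
  have "A * (1 + r) * \<eta>\<^sup>2 + p ^ 3
        < A * (1 + r) * (\<eta> - of_int n)\<^sup>2 + \<bar>p + of_int n - D * of_int m\<bar> ^ 3"
    if D: "D \<ge> D0" and r: "\<bar>r\<bar> \<le> 1/2" "\<bar>r\<bar> * (1 + 2 * \<bar>\<eta>\<bar>) < 1"
      and nm: "n \<noteq> 0 \<or> m \<noteq> 0" for D r and n m :: int
  proof (cases "m = 0")
    case True
    define k where "k = real_of_int n"
    have k1: "\<bar>k\<bar> \<ge> 1" using nm True unfolding k_def by linarith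
    \<comment> \<open>By \<open>crit\<close> the slope \<open>3 * p^2\<close> of the cube is
      \<open>2 * A * \<eta>\<close>. It cancels the linear part of the square up to the error
      \<open>2 * A * r * \<eta> * k\<close>, which is absorbed by \<open>k^2\<close> because
      \<open>|k| \<ge> 1\<close>.\<close>
    have tangent: "p ^ 3 + 2 * A * \<eta> * k \<le> \<bar>p + k\<bar> ^ 3"
      using abs_cube_tangent_le[of p "p + k"] p crit by (simp add: power2_eq_square)
    have "2 * r * \<eta> * k \<le> (2 * \<bar>r\<bar> * \<bar>\<eta>\<bar>) * \<bar>k\<bar>"
      using abs_ge_self[of "2 * r * \<eta> * k"] by (simp add: abs_mult)
    also have "\<dots> \<le> (2 * \<bar>r\<bar> * \<bar>\<eta>\<bar>) * k\<^sup>2"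
    proof -
      have "\<bar>k\<bar> * 1 \<le> \<bar>k\<bar> * \<bar>k\<bar>" using k1 by (intro mult_left_mono) auto
      then show ?thesis by (intro mult_left_mono) (auto simp: power2_eq_square)
    qed
    also have "\<dots> < (1 + r) * k\<^sup>2"
    proof -
      have "2 * \<bar>r\<bar> * \<bar>\<eta>\<bar> < 1 + r" using r(2) by (simp add: algebra_simps)
      moreover have "k\<^sup>2 > 0" using k1 by auto
      ultimately show ?thesis by (intro mult_strict_right_mono)
    qed
    finally have "0 < A * ((1 + r) * k\<^sup>2 - 2 * r * \<eta> * k)" using A by simp
    then show ?thesis
      using tangent True by (simp add: k_def power2_eq_square algebra_simps)
  next
    case False
    have "A * (1 + r) * \<eta>\<^sup>2 \<le> A * (3/2) * \<eta>\<^sup>2"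
      using A r(1) by (intro mult_right_mono mult_left_mono) auto
    then have E': "A * (1 + r) * \<eta>\<^sup>2 + p ^ 3 \<le> E" by (simp add: E_def)
    define s where "s = \<bar>\<eta> - real_of_int n\<bar>"
    have nonneg: "0 \<le> A * (1 + r) * (\<eta> - of_int n)\<^sup>2" using A r(1) by simp
    show ?thesis
    proof (cases "s \<ge> R")
      case True
      have "E < A * (1/2) * R" using A by (simp add: R_def field_simps)
      also have "\<dots> \<le> A * (1/2) * s\<^sup>2"
      proof -
        have "R * 1 \<le> s * s" using True R by (intro mult_mono) auto
        then show ?thesis using A by (simp add: power2_eq_square)
      qed
      also have "\<dots> \<le> A * (1 + r) * s\<^sup>2"
        using A r(1) by (intro mult_right_mono mult_left_mono) auto
      finally have "E < A * (1 + r) * (\<eta> - of_int n)\<^sup>2" by (simp add: s_def)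
      then show ?thesis using E' zero_le_power[OF abs_ge_zero, of "p + of_int n - D * of_int m" 3]
        by linarith
    next
      case far: False
      have "D > 0" using D p R E by (simp add: D0_def)
      have "D * 1 \<le> D * \<bar>real_of_int m\<bar>"
        using False \<open>D > 0\<close> by (intro mult_left_mono) auto
      then have "D \<le> \<bar>D * of_int m\<bar>" using \<open>D > 0\<close> by (simp add: abs_mult)
      then have "E + 1 \<le> \<bar>p + of_int n - D * of_int m\<bar>"
        using far D p unfolding D0_def s_def by linarith
      then have "(E + 1) ^ 3 \<le> \<bar>p + of_int n - D * of_int m\<bar> ^ 3"
        using E by (intro power_mono) auto
      moreover have "E + 1 \<le> (E + 1) ^ 3" using E by (intro self_le_power) auto
      ultimately show ?thesis using E' nonneg by linarith
    qed
  qed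
  then show ?thesis by blast
qed

text \<open>The two critical-point conditions place the layer minima at \<open>n = 0\<close> and
  \<open>n = l\<close>. The choice of \<open>\<alpha>\<close> keeps
  \<open>6 * C * \<alpha>^2 = A\<close> as \<open>C\<close> grows, and the eventual form lets
  several \<open>l\<close> share one lattice.\<close>

lemma eventually_voronoi_relevant:
  fixes A p q \<eta> \<tau> :: real and l :: int
  assumes A: "A > 0" and p: "p \<ge> 0" and q: "q \<ge> 0" "q = p - \<tau> + of_int l"
    and crit_p: "2 * A * \<eta> = 3 * p\<^sup>2" and crit_q: "2 * A * (\<eta> - of_int l) = 3 * q\<^sup>2"
  shows "\<forall>\<^sub>F C in at_top. \<forall>\<^sub>F D in at_top.
    voronoi_relevant l3_norm (lattice C (sqrt (A / (6 * C))) \<tau> D)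
      (latvec C (sqrt (A / (6 * C))) \<tau> D 1 l 0)"
proof -
  define \<theta> where "\<theta> = \<eta> - of_int l"
  \<comment> \<open>\<open>\<rho>\<close> bounds \<open>|r|\<close> so that
    \<open>layer_minimum\<close> applies to both layers. \<open>M\<close> bounds, for
    \<open>|r| \<le> 1/2\<close>, the parts of both cubed distances that do not grow with
    \<open>C\<close>.\<close>
  define \<rho> where "\<rho> = 1 / (2 * (1 + 2 * \<bar>\<eta>\<bar> + 2 * \<bar>\<theta>\<bar>))"
  define M where "M = A * (3/2) * \<eta>\<^sup>2 + A * (3/2) * \<theta>\<^sup>2 + p ^ 3 + q ^ 3"
  have \<rho>: "\<rho> > 0" "\<rho> \<le> 1/2" by (auto simp: \<rho>_def field_simps add_pos_nonneg)
  have \<rho>': "\<rho> * (1 + 2 * \<bar>\<eta>\<bar>) < 1" "\<rho> * (1 + 2 * \<bar>\<theta>\<bar>) < 1"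
    by (auto simp: \<rho>_def field_simps add_pos_nonneg)
  have M_terms: "0 \<le> A * \<eta>\<^sup>2" "0 \<le> A * \<theta>\<^sup>2" "0 \<le> p ^ 3" "0 \<le> q ^ 3" using A p q by auto
  have M: "M \<ge> 0" "A * (3/2) * \<eta>\<^sup>2 + p ^ 3 \<le> M" "A * (3/2) * \<theta>\<^sup>2 + q ^ 3 \<le> M"
    using M_terms by (auto simp: M_def)
  obtain D1 where D1: "\<And>D r n m. D \<ge> D1 \<Longrightarrow> \<bar>r\<bar> \<le> 1/2 \<Longrightarrow> \<bar>r\<bar> * (1 + 2 * \<bar>\<eta>\<bar>) < 1 \<Longrightarrow>
      n \<noteq> 0 \<or> m \<noteq> 0 \<Longrightarrow> A * (1 + r) * \<eta>\<^sup>2 + p ^ 3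
        < A * (1 + r) * (\<eta> - of_int n)\<^sup>2 + \<bar>p + of_int n - D * of_int m\<bar> ^ 3"
    using layer_minimum[OF A p crit_p] by blast
  obtain D2 where D2: "\<And>D r n m. D \<ge> D2 \<Longrightarrow> \<bar>r\<bar> \<le> 1/2 \<Longrightarrow> \<bar>r\<bar> * (1 + 2 * \<bar>\<theta>\<bar>) < 1 \<Longrightarrow>
      n \<noteq> 0 \<or> m \<noteq> 0 \<Longrightarrow> A * (1 + r) * \<theta>\<^sup>2 + q ^ 3
        < A * (1 + r) * (\<theta> - of_int n)\<^sup>2 + \<bar>q + of_int n - D * of_int m\<bar> ^ 3"
    using layer_minimum[OF A q(1) crit_q] unfolding \<theta>_def by blast
  have relevant: "voronoi_relevant l3_norm (lattice C \<alpha> \<tau> D) (latvec C \<alpha> \<tau> D 1 l 0)"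
    if C: "C \<ge> 1" "C \<ge> M / \<rho>" and \<alpha>: "\<alpha> = sqrt (A / (6 * C))"
      and D: "D \<ge> D1" "D \<ge> D2" "D > 0" for C D \<alpha>
  proof -
    have C0: "C > 0" using C by simp
    have C3: "C \<le> C ^ 3" using C by (intro self_le_power) auto
    have "\<alpha> > 0" using A C0 by (simp add: \<alpha>)
    have A\<alpha>: "A = 6 * C * \<alpha>\<^sup>2" using A C0 by (simp add: \<alpha> field_simps)
    have MC\<rho>: "M \<le> C * \<rho>" using C(2) \<rho> by (simp add: field_simps)
    also have "\<dots> \<le> C * 1" using C0 \<rho> by (intro mult_left_mono) auto
    finally have MC: "M \<le> C" by simp
    have "C * \<rho> \<le> C ^ 3 * \<rho>" using C3 \<rho> by (intro mult_right_mono) auto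
    with MC\<rho> have MC3\<rho>: "M \<le> C ^ 3 * \<rho>" by simp
    \<comment> \<open>This is the condition for the exact distance formula; it holds since
      \<open>M \<le> C\<close>.\<close>
    have narrow: "\<bar>\<alpha> * y\<bar> \<le> C * t" if "A * (3/2) * y\<^sup>2 \<le> M" "t \<ge> 1/2" for y t
    proof -
      have "6 * C * (\<alpha> * y)\<^sup>2 = A * y\<^sup>2" by (simp add: A\<alpha> power_mult_distrib)
      also have "\<dots> \<le> C ^ 3" using that MC C3 M by linarith
      also have "\<dots> = C * C\<^sup>2" by (simp add: power2_eq_square power3_eq_cube)
      finally have "C * (6 * (\<alpha> * y)\<^sup>2) \<le> C * C\<^sup>2" by (simp add: ac_simps)
      then have "6 * (\<alpha> * y)\<^sup>2 \<le> C\<^sup>2" using C0 by simp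
      then have "4 * (\<alpha> * y)\<^sup>2 \<le> C\<^sup>2" using zero_le_power2[of "\<alpha> * y"] by linarith
      then have "(\<alpha> * y)\<^sup>2 \<le> (C * (1/2))\<^sup>2"
        unfolding power_mult_distrib[of C] power_divide by simp
      then have "\<bar>\<alpha> * y\<bar> \<le> C * (1/2)" using C0 abs_le_square_iff[of "\<alpha> * y" "C * (1/2)"] by simp
      also have "\<dots> \<le> C * t" using C0 that by (intro mult_left_mono) auto
      finally show ?thesis .
    qed
    \<comment> \<open>The cubed distance to 0 minus that to
      \<open>latvec C \<alpha> \<tau> D 1 l 0\<close>. At \<open>r = \<rho>\<close> and
      \<open>r = -\<rho>\<close> the term \<open>12 * C^3 * r\<close> outweighs \<open>M\<close>,
      forcing a sign change.\<close>
    define f where "f r = 2 * C ^ 3 * (1 + r) ^ 3 + A * (1 + r) * \<eta>\<^sup>2 + p ^ 3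
        - (2 * C ^ 3 * (1 - r) ^ 3 + A * (1 - r) * \<theta>\<^sup>2 + q ^ 3)" for r
    have f: "f r = C ^ 3 * (12 * r + 4 * r ^ 3) + (A * (1 + r) * \<eta>\<^sup>2 + p ^ 3)
        - (A * (1 - r) * \<theta>\<^sup>2 + q ^ 3)" for r
      by (simp add: f_def power3_eq_cube algebra_simps)
    have bounds: "0 \<le> A * (1 + r) * y\<^sup>2" "A * (1 + r) * y\<^sup>2 \<le> A * (3/2) * y\<^sup>2"
      if r: "\<bar>r\<bar> \<le> 1/2" for r y
    proof -
      show "0 \<le> A * (1 + r) * y\<^sup>2" using r A by simp
      show "A * (1 + r) * y\<^sup>2 \<le> A * (3/2) * y\<^sup>2"
        using r A by (intro mult_right_mono mult_left_mono) auto
    qed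
    have gain: "C ^ 3 * (12 * \<rho> + 4 * \<rho> ^ 3) \<ge> M"
    proof -
      have "C ^ 3 * \<rho> \<le> C ^ 3 * (12 * \<rho> + 4 * \<rho> ^ 3)"
        using C0 \<rho> by (intro mult_left_mono) auto
      then show ?thesis using MC3\<rho> by simp
    qed
    have abs_\<rho>: "\<bar>\<rho>\<bar> \<le> 1/2" "\<bar>-\<rho>\<bar> \<le> 1/2" using \<rho> by auto
    have "C ^ 3 * (12 * (-\<rho>) + 4 * (-\<rho>) ^ 3) = - (C ^ 3 * (12 * \<rho> + 4 * \<rho> ^ 3))"
      by (simp add: algebra_simps)
    then have "f (-\<rho>) \<le> 0"
      using gain bounds(2)[OF abs_\<rho>(2), of \<eta>] bounds(1)[OF abs_\<rho>(1), of \<theta>] M M_terms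
      unfolding f minus_minus diff_minus_eq_add by linarith
    moreover have "0 \<le> f \<rho>"
      using gain bounds(2)[OF abs_\<rho>(2), of \<theta>] bounds(1)[OF abs_\<rho>(1), of \<eta>] M M_terms
      unfolding f by (simp only: add_uminus_conv_diff)
    moreover have "continuous_on {-\<rho>..\<rho>} f"
      unfolding f_def by (intro continuous_intros)
    ultimately obtain r where r: "-\<rho> \<le> r" "r \<le> \<rho>" "f r = 0"
      using IVT'[of f "-\<rho>" 0 \<rho>] \<rho> by auto
    have r_half: "\<bar>r\<bar> \<le> 1/2" "\<bar>-r\<bar> \<le> 1/2" using r \<rho> by auto
    have r_small: "\<bar>r\<bar> * (1 + 2 * \<bar>\<eta>\<bar>) < 1" "\<bar>-r\<bar> * (1 + 2 * \<bar>\<theta>\<bar>) < 1"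
    proof -
      have "\<bar>r\<bar> * (1 + 2 * \<bar>\<eta>\<bar>) \<le> \<rho> * (1 + 2 * \<bar>\<eta>\<bar>)" "\<bar>r\<bar> * (1 + 2 * \<bar>\<theta>\<bar>) \<le> \<rho> * (1 + 2 * \<bar>\<theta>\<bar>)"
        using r by (auto intro!: mult_right_mono)
      then show "\<bar>r\<bar> * (1 + 2 * \<bar>\<eta>\<bar>) < 1" "\<bar>-r\<bar> * (1 + 2 * \<bar>\<theta>\<bar>) < 1" using \<rho>' by auto
    qed
    define x where "x = probe C \<alpha> r \<eta> p"
    note dist = cube_sum_probe_diff[OF C0 A\<alpha>, where r = r and \<eta> = \<eta> and p = p and \<tau> = \<tau>
        and D = D, folded x_def]
    have zero: "latvec C \<alpha> \<tau> D 0 0 0 = 0" using latvec_eq_0_iff C0 \<open>\<alpha> > 0\<close> D by simp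
    define v where "v = latvec C \<alpha> \<tau> D 1 l 0"
    have slim: "\<bar>\<alpha> * \<eta>\<bar> \<le> C * (1 + r)" "\<bar>\<alpha> * \<theta>\<bar> \<le> C * (1 - r)"
    proof -
      have "A * (3/2) * \<eta>\<^sup>2 \<le> M" "A * (3/2) * \<theta>\<^sup>2 \<le> M" using M M_terms by linarith+
      then show "\<bar>\<alpha> * \<eta>\<bar> \<le> C * (1 + r)" "\<bar>\<alpha> * \<theta>\<bar> \<le> C * (1 - r)"
        using r_half by (auto intro!: narrow)
    qed
    have x: "cube_sum x = 2 * C ^ 3 * (1 + r) ^ 3 + A * (1 + r) * \<eta>\<^sup>2 + p ^ 3"
      using dist(2)[where j = 0 and n = 0 and m = 0] slim(1) r_half p zero by simp
    have "cube_sum (x - v) = 2 * C ^ 3 * (1 - r) ^ 3 + A * (1 - r) * \<theta>\<^sup>2 + q ^ 3"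
      using dist(2)[where j = 1 and n = l and m = 0] slim(2) r_half q by (simp add: v_def \<theta>_def)
    with r(3) have xv: "cube_sum (x - v) = cube_sum x"
      and xv': "cube_sum (x - v) = 2 * C ^ 3 * (1 - r) ^ 3 + A * (1 - r) * \<theta>\<^sup>2 + q ^ 3"
      by (simp_all add: x f_def)
    have "cube_sum (x - v) < cube_sum (x - w)" if w: "w \<in> lattice C \<alpha> \<tau> D - {0, v}" for w
    proof -
      obtain j n m where w_eq: "w = latvec C \<alpha> \<tau> D j n m" using w by (auto simp: lattice_def)
      consider "j = 0" | "j = 1" | "j \<le> -1 \<or> j \<ge> 2" by linarith
      then show ?thesis
      proof cases
        case 1
        then have "n \<noteq> 0 \<or> m \<noteq> 0" using w w_eq zero by auto
        then show ?thesis
          using D1[OF D(1) r_half(1) r_small(1), of n m] dist(1)[where j = 0 and n = n and m = m] r_half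
          by (simp add: 1 w_eq xv x)
      next
        case 2
        then have nm: "n - l \<noteq> 0 \<or> m \<noteq> 0" using w w_eq v_def by auto
        \<comment> \<open>Translating \<open>n\<close> by \<open>l\<close> brings the layer
          \<open>j = 1\<close> into the form of \<open>layer_minimum\<close>, with
          \<open>-r\<close>, \<open>\<theta>\<close>, \<open>q\<close> in place of \<open>r\<close>,
          \<open>\<eta>\<close>, \<open>p\<close>.\<close>
        have shift: "q + of_int (n - l) - D * of_int m = p - \<tau> + of_int n - D * of_int m"
          "\<theta> - of_int (n - l) = \<eta> - of_int n" by (simp_all add: q(2) \<theta>_def)
        show ?thesis
          using D2[OF D(2) r_half(2) r_small(2) nm, unfolded shift]
            dist(1)[where j = 1 and n = n and m = m] r_half
          by (simp add: 2 w_eq xv')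
      next
        case 3
        \<comment> \<open>Other layers lose by the leading term alone: \<open>5/2\<close> against at
          most \<open>3/2\<close>, a gap of order \<open>C^3\<close> that beats
          \<open>M\<close>.\<close>
        have "5/2 \<le> \<bar>1 + r - 2 * real_of_int j\<bar>" using 3 r_half by linarith
        then have "(5/2) ^ 3 \<le> \<bar>1 + r - 2 * real_of_int j\<bar> ^ 3" by (intro power_mono) auto
        then have "2 * C ^ 3 * (5/2) ^ 3 \<le> 2 * C ^ 3 * \<bar>1 + r - 2 * real_of_int j\<bar> ^ 3"
          using C0 by (intro mult_left_mono) auto
        also have "\<dots> \<le> cube_sum (x - w)"
        proof -
          have "0 \<le> A * \<bar>1 + r - 2 * real_of_int j\<bar> * (\<eta> - real_of_int n)\<^sup>2" using A by simp
          then show ?thesis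
            using dist(1)[where j = j and n = n and m = m]
              zero_le_power[OF abs_ge_zero, of "p - \<tau> * of_int j + of_int n - D * of_int m" 3]
            unfolding w_eq by linarith
        qed
        finally have far: "2 * C ^ 3 * (5/2) ^ 3 \<le> cube_sum (x - w)" .
        have "(1 + r) ^ 3 \<le> (3/2) ^ 3" using r_half by (intro power_mono) auto
        then have "2 * C ^ 3 * (1 + r) ^ 3 \<le> 2 * C ^ 3 * (3/2) ^ 3"
          using C0 by (intro mult_left_mono) auto
        then have "cube_sum x \<le> 2 * C ^ 3 * (3/2) ^ 3 + M"
          unfolding x using bounds(2)[OF r_half(1), of \<eta>] M by linarith
        also have "\<dots> < 2 * C ^ 3 * (5/2) ^ 3"
          using MC C3 C0 by (simp add: power_divide)
        finally show ?thesis using far xv by simp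
      qed
    qed
    moreover have "v \<in> lattice C \<alpha> \<tau> D - {0}"
      using latvec_eq_0_iff[of C \<alpha> D \<tau> 1 l 0] C0 \<open>\<alpha> > 0\<close> D
      by (auto simp: v_def lattice_def)
    ultimately show ?thesis
      unfolding voronoi_relevant_def v_def[symmetric] l3_norm_less_iff l3_norm_eq_iff
      using xv by (intro conjI exI[of _ x]) auto
  qed
  show ?thesis
    using eventually_ge_at_top[of 1] eventually_ge_at_top[of "M / \<rho>"]
  proof eventually_elim
    case (elim C)
    show ?case
      using eventually_ge_at_top[of D1] eventually_ge_at_top[of D2] eventually_gt_at_top[of 0]
      by eventually_elim (rule relevant[OF elim refl])
  qed
qed

section \<open>One lattice for all \<open>l\<close> from 1 to \<open>k\<close>\<close>

text \<open>Only finitely many \<open>l\<close> occur, so a common \<open>C\<close> and then a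
  common \<open>D\<close> exist. The vectors are distinct because their coefficients
  \<open>n = l\<close> are.\<close>

theorem theorem7:
  shows "is_norm l3_norm \<and> smooth l3_norm \<and> strictly_convex l3_norm \<and>
    (\<forall>k::nat. 0 < k \<longrightarrow>
      (\<exists>L :: (real ^ 3) set. full_rank_lattice L \<and>
        (\<exists>V. V \<subseteq> {v. voronoi_relevant l3_norm L v} \<and> finite V \<and> k \<le> card V)))"
proof (intro conjI allI impI)
  show "is_norm l3_norm" "smooth l3_norm" "strictly_convex l3_norm"
    by (rule is_norm_l3_norm l3_norm_smooth l3_norm_strictly_convex)+
next
  fix k :: nat
  assume k: "0 < k"
  define \<tau> where "\<tau> = 2 * real k"
  define A where "A = 6 * \<tau>\<^sup>2"
  let ?I = "{1..int k}"
  have \<tau>: "\<tau> > 0" and A: "A > 0" using k by (auto simp: \<tau>_def A_def)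
  have "\<forall>\<^sub>F C in at_top. \<forall>\<^sub>F D in at_top.
    voronoi_relevant l3_norm (lattice C (sqrt (A / (6 * C))) \<tau> D)
      (latvec C (sqrt (A / (6 * C))) \<tau> D 1 l 0)" if "l \<in> ?I" for l
  proof -
    \<comment> \<open>\<open>\<tau> = 2 * k\<close> makes \<open>d\<close> positive for every
      \<open>l \<le> k\<close>. The third-coordinate offset in the layer \<open>j = 1\<close> is
      then \<open>q = p - d\<close>.\<close>
    define d where "d = \<tau> - of_int l"
    have l: "1 \<le> real_of_int l" "real_of_int l \<le> real k" using that by auto
    then have d: "0 < d" "d < \<tau>" using k by (auto simp: d_def \<tau>_def)
    \<comment> \<open>Subtracting the two critical-point conditions eliminates \<open>\<eta>\<close>
      and leaves \<open>d * (2 * p - d) = 4 * \<tau>^2 * l\<close>, which is solved for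
      \<open>p\<close>; the first condition then gives \<open>\<eta>\<close>.\<close>
    define p where "p = d / 2 + 2 * \<tau>\<^sup>2 * of_int l / d"
    define \<eta> where "\<eta> = p\<^sup>2 / (4 * \<tau>\<^sup>2)"
    have "p \<ge> 0" using d l by (simp add: p_def)
    \<comment> \<open>After clearing denominators, \<open>q \<ge> 0\<close> is exactly
      \<open>d^2 \<le> 4 * \<tau>^2 * l\<close>.\<close>
    have "d * d \<le> \<tau> * \<tau>" using d by (intro mult_mono) auto
    also have "\<dots> \<le> 4 * \<tau>\<^sup>2 * of_int l"
    proof -
      have "\<tau>\<^sup>2 * 1 \<le> \<tau>\<^sup>2 * (4 * of_int l)" using l by (intro mult_left_mono) auto
      then show ?thesis by (simp add: power2_eq_square)
    qed
    finally have "p - d \<ge> 0" using d by (simp add: p_def field_simps)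
    have crit: "2 * A * \<eta> = 3 * p\<^sup>2" using \<tau> by (simp add: A_def \<eta>_def)
    have "3 * p\<^sup>2 - 3 * (p - d)\<^sup>2 = 3 * (d * (2 * p - d))"
      by (simp add: power2_eq_square algebra_simps)
    also have "d * (2 * p - d) = 4 * \<tau>\<^sup>2 * of_int l" using d by (simp add: p_def field_simps)
    finally have "2 * A * (\<eta> - of_int l) = 3 * (p - d)\<^sup>2"
      using crit by (simp add: A_def algebra_simps)
    then show ?thesis
      using eventually_voronoi_relevant[OF A \<open>p \<ge> 0\<close> \<open>p - d \<ge> 0\<close> _ crit, of \<tau> l]
      by (simp add: d_def)
  qed
  then have "\<forall>\<^sub>F C in at_top. \<forall>l\<in>?I. \<forall>\<^sub>F D in at_top.
    voronoi_relevant l3_norm (lattice C (sqrt (A / (6 * C))) \<tau> D)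
      (latvec C (sqrt (A / (6 * C))) \<tau> D 1 l 0)"
    by (intro eventually_ball_finite) auto
  from eventually_happens'[OF _ eventually_conj[OF eventually_gt_at_top[of 0] this]]
  obtain C where C: "C > 0" "\<forall>l\<in>?I. \<forall>\<^sub>F D in at_top.
      voronoi_relevant l3_norm (lattice C (sqrt (A / (6 * C))) \<tau> D)
        (latvec C (sqrt (A / (6 * C))) \<tau> D 1 l 0)"
    by auto
  define \<alpha> where "\<alpha> = sqrt (A / (6 * C))"
  have \<alpha>: "\<alpha> > 0" using A C by (simp add: \<alpha>_def)
  have "\<forall>\<^sub>F D in at_top. \<forall>l\<in>?I. voronoi_relevant l3_norm (lattice C \<alpha> \<tau> D) (latvec C \<alpha> \<tau> D 1 l 0)"
    using C(2) by (intro eventually_ball_finite) (auto simp: \<alpha>_def)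
  from eventually_happens'[OF _ eventually_conj[OF eventually_gt_at_top[of 0] this]]
  obtain D where D: "D > 0"
    "\<forall>l\<in>?I. voronoi_relevant l3_norm (lattice C \<alpha> \<tau> D) (latvec C \<alpha> \<tau> D 1 l 0)"
    by auto
  define V where "V = (\<lambda>l. latvec C \<alpha> \<tau> D 1 l 0) ` ?I"
  have "inj_on (\<lambda>l. latvec C \<alpha> \<tau> D 1 l 0) ?I"
  proof (rule inj_onI)
    fix l l' assume "latvec C \<alpha> \<tau> D 1 l 0 = latvec C \<alpha> \<tau> D 1 l' 0"
    then have "latvec C \<alpha> \<tau> D 0 (l - l') 0 = 0"
      using latvec_diff[of C \<alpha> \<tau> D 1 l 0 1 l' 0] by simp
    then show "l = l'" using latvec_eq_0_iff[of C \<alpha> D] C \<alpha> D by simp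
  qed
  then have "card V = k" by (simp add: V_def card_image)
  moreover have "finite V" "V \<subseteq> {v. voronoi_relevant l3_norm (lattice C \<alpha> \<tau> D) v}"
    using D(2) by (auto simp: V_def)
  moreover have "full_rank_lattice (lattice C \<alpha> \<tau> D)"
    using full_rank_lattice_lattice C \<alpha> D by blast
  ultimately show "\<exists>L :: (real ^ 3) set. full_rank_lattice L \<and>
        (\<exists>V. V \<subseteq> {v. voronoi_relevant l3_norm L v} \<and> finite V \<and> k \<le> card V)"
    by (metis order_refl)
qed

end
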